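(* Let $\Omega\subset\mathbb{R}^d$ be a Lebesgue measurable set with $|\Omega|=\infty$. Then there is no frame of windowed exponentials on $L^2(\Omega)$; that is, for every finite $q\ge 1$, all $g_1,\dots,g_q\in L^2(\Omega)\setminus\{0\}$ and all countable sets $\Lambda_1,\dots,\Lambda_q\subset\mathbb{R}^d$, the collection $\bigcup_{j=1}^{q}\mathcal{E}(g_j,\Lambda_j)$ is not a frame for $L^2(\Omega)$.
   Context: $|\Omega|$ denotes Lebesgue measure. For $g_j\in L^2(\Omega)\setminus\{0\}$ and countable $\Lambda_j\subset\mathbb{R}^d$, $j=1,\dots,q$, $q<\infty$, put $\mathcal{E}(g_j,\Lambda_j)=\{g_j(x)e^{2\pi i\langle\lambda,x\rangle}:\lambda\in\Lambda_j\}$. The collection $\bigcup_{j=1}^q\mathcal{E}(g_j,\Lambda_j)$ (indexed by pairs $(j,\lambda)$, $\lambda\in\Lambda_j$) is called a set of windowed exponentials with windows $g_j$. It is a frame for $L^2(\Omega)$ if there exist constants $0<A,B<\infty$ such that for all $f\in L^2(\Omega)$ $$A\|f\|_{L^2(\Omega)}^2\le\sum_{j=1}^q\sum_{\lambda\in\Lambda_j}\left|\int_\Omega f(x)\overline{g_j(x)}e^{-2\pi i\langle\lambda,x\rangle}dx\right|^2\le B\|f\|_{L^2(\Omega)}^2 .$$ *)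

theory Defs
  imports "HOL-Analysis.Analysis"
begin

text \<open>
  An element of $L^2(\Omega)$ is given by a representative defined on the whole space; only its
  restriction to \<open>\<Omega>\<close> matters, since all conditions refer to \<^term>\<open>lebesgue_on \<Omega>\<close>.
\<close>

definition L2_space :: "(real ^ 'd) set \<Rightarrow> (real ^ 'd \<Rightarrow> complex) set" where
  "L2_space \<Omega> = {f \<in> borel_measurable (lebesgue_on \<Omega>).
                   integrable (lebesgue_on \<Omega>) (\<lambda>x. (cmod (f x))\<^sup>2)}"

definition L2_norm :: "(real ^ 'd) set \<Rightarrow> (real ^ 'd \<Rightarrow> complex) \<Rightarrow> real" where
  "L2_norm \<Omega> f = sqrt (LINT x|lebesgue_on \<Omega>. (cmod (f x))\<^sup>2)"

definition L2_inner ::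
  "(real ^ 'd) set \<Rightarrow> (real ^ 'd \<Rightarrow> complex) \<Rightarrow> (real ^ 'd \<Rightarrow> complex) \<Rightarrow> complex" where
  "L2_inner \<Omega> f h = (LINT x|lebesgue_on \<Omega>. f x * cnj (h x))"

text \<open>The zero element of $L^2(\Omega)$ is the class of functions vanishing almost everywhere.\<close>

definition L2_nonzero :: "(real ^ 'd) set \<Rightarrow> (real ^ 'd \<Rightarrow> complex) set" where
  "L2_nonzero \<Omega> = {f \<in> L2_space \<Omega>. \<not> (AE x in lebesgue_on \<Omega>. f x = 0)}"

definition windowed_exp ::
  "(real ^ 'd \<Rightarrow> complex) \<Rightarrow> real ^ 'd \<Rightarrow> real ^ 'd \<Rightarrow> complex" where
  "windowed_exp g l x = g x * exp (2 * of_real pi * \<i> * of_real (l \<bullet> x))"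

lemma L2_inner_windowed_exp:
  "L2_inner \<Omega> f (windowed_exp g l) =
     (LINT x|lebesgue_on \<Omega>. f x * cnj (g x) * exp (- 2 * of_real pi * \<i> * of_real (l \<bullet> x)))"
  by (simp add: L2_inner_def windowed_exp_def exp_cnj mult.assoc)

text \<open>
  The family is indexed by the pairs \<open>(j, l)\<close> with \<open>j \<in> {1..q}\<close> and \<open>l \<in> \<Lambda> j\<close>, so
  elements that coincide for different \<open>j\<close> are counted separately. The sums are taken in
  $[0,\infty]$ (\<^typ>\<open>ennreal\<close>), where they always exist; the upper bound then forces
  convergence.
\<close>

definition windowed_exp_frame ::
  "(real ^ 'd) set \<Rightarrow> nat \<Rightarrow> (nat \<Rightarrow> real ^ 'd \<Rightarrow> complex) \<Rightarrow> (nat \<Rightarrow> (real ^ 'd) set) \<Rightarrow> bool" where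
  "windowed_exp_frame \<Omega> q g \<Lambda> \<longleftrightarrow>
     (\<exists>A B :: real. 0 < A \<and> 0 < B \<and>
       (\<forall>f \<in> L2_space \<Omega>.
          ennreal (A * (L2_norm \<Omega> f)\<^sup>2)
            \<le> (\<Sum>j = 1..q. \<Sum>\<^sub>\<infinity>l\<in>\<Lambda> j. ennreal ((cmod (L2_inner \<Omega> f (windowed_exp (g j) l)))\<^sup>2)) \<and>
          (\<Sum>j = 1..q. \<Sum>\<^sub>\<infinity>l\<in>\<Lambda> j. ennreal ((cmod (L2_inner \<Omega> f (windowed_exp (g j) l)))\<^sup>2))
            \<le> ennreal (B * (L2_norm \<Omega> f)\<^sup>2)))"

end

theory Submission
  imports Defs "HOL-Probability.Characteristic_Functions"
begin

text \<open>
  Let the family be a frame with bounds \<open>A\<close> and \<open>B\<close>. Testing the upper bound on the modulated windows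
  themselves shows that each \<open>\<Lambda> j\<close> has at most \<open>C j\<close> points in any ball of a fixed small radius \<open>\<delta>\<close>.
  For \<open>E = \<Omega> \<inter> ball 0 n\<close>, average the lower bound for the modulated indicator functions
  $1_E(x) e^{-2\pi i\langle t,x\rangle}$ over \<open>t \<in> ball 0 \<delta>\<close>: the sum over \<open>\<Lambda> j\<close> becomes an integral of
  $|\widehat{1_E \overline{g_j}}|^2$ against a density bounded by \<open>C j\<close>, so Plancherel's inequality gives
  \<open>A |E| |ball 0 \<delta>| \<le> (\<Sum>j. C j \<parallel>g j\<parallel>\<^sup>2)\<close>. The right-hand side does not depend on \<open>n\<close>, whereas
  \<open>|E| \<rightarrow> |\<Omega>| = \<infinity>\<close>. Only the inequality half of Plancherel's theorem is needed; it follows by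
  inserting a wide Gaussian weight, whose Fourier transform is a positive kernel of mass 1.
\<close>

section \<open>Countable sums in [0,\<infinity>] as integrals\<close>

text \<open>In [0,\<infinity>] every family is summable, so an enumeration of an infinite
  \<open>A\<close> turns both sides into the same series. Written as an integral over
  \<open>count_space A\<close>, a frame sum becomes accessible to Tonelli's theorem.\<close>

lemma ennreal_infsum_eq_nn_integral:
  fixes f :: "'a \<Rightarrow> ennreal"
  assumes "countable A"
  shows "(\<Sum>\<^sub>\<infinity>x\<in>A. f x) = (\<integral>\<^sup>+x. f x \<partial>count_space A)"
proof (cases "finite A")
  case True
  then show ?thesis by (simp add: nn_integral_count_space_finite)
next
  case False
  define e where "e = from_nat_into A"
  have bij: "bij_betw e UNIV A"
    unfolding e_def using assms False by (rule bij_betw_from_nat_into)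
  have "(\<lambda>n. f (e n)) sums (\<Sum>\<^sub>\<infinity>n. f (e n))"
    by (intro has_sum_imp_sums has_sum_infsum nonneg_summable_on_complete) auto
  then have "(\<Sum>\<^sub>\<infinity>n. f (e n)) = (\<Sum>n. f (e n))"
    by (simp add: sums_iff)
  also have "\<dots> = (\<integral>\<^sup>+n. f (e n) \<partial>count_space UNIV)"
    by (simp add: nn_integral_count_space_nat)
  also have "\<dots> = (\<integral>\<^sup>+x. f x \<partial>count_space A)"
    by (rule nn_integral_bij_count_space[OF bij])
  finally show ?thesis
    using infsum_reindex_bij_betw[OF bij, of f] by simp
qed

lemma borel_measurable_cis [measurable (raw)]:
  assumes "f \<in> borel_measurable M"
  shows "(\<lambda>x. cis (f x)) \<in> borel_measurable M"
  by (rule measurable_compose[OF assms])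
    (auto intro!: borel_measurable_continuous_onI continuous_intros)

section \<open>Fourier transforms of Gaussians\<close>

text \<open>Lebesgue measure on a Euclidean space is the image of the product of one-dimensional
  Lebesgue measures under the map that assembles a vector from its coordinates, so Fubini applies
  factor by factor.\<close>

lemma
  fixes \<phi> :: "'a :: euclidean_space \<Rightarrow> real \<Rightarrow> 'b :: {real_normed_field, banach, second_countable_topology}"
  assumes int: "\<And>b. b \<in> Basis \<Longrightarrow> integrable lborel (\<phi> b)"
  shows integrable_lborel_prod: "integrable lborel (\<lambda>x. \<Prod>b\<in>Basis. \<phi> b (x \<bullet> b))"
    and integral_lborel_prod:
      "(LINT x|lborel. (\<Prod>b\<in>Basis. \<phi> b (x \<bullet> b))) = (\<Prod>b\<in>Basis. (LINT t|lborel. \<phi> b t))"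
proof -
  interpret product_sigma_finite "\<lambda>_::'a. lborel :: real measure" ..
  have [measurable]: "\<phi> b \<in> borel_measurable borel" if "b \<in> Basis" for b
    using borel_measurable_integrable[OF int[OF that]] by simp
  have inner: "(\<Sum>c\<in>Basis. x c *\<^sub>R c) \<bullet> b = x b" if "b \<in> Basis" for x and b :: 'a
    using that by simp
  show "integrable lborel (\<lambda>x. \<Prod>b\<in>Basis. \<phi> b (x \<bullet> b))"
    unfolding lborel_eq[where 'a='a]
    by (subst integrable_distr_eq) (auto simp: int intro!: product_integrable_prod cong: prod.cong)
  show "(LINT x|lborel. (\<Prod>b\<in>Basis. \<phi> b (x \<bullet> b))) = (\<Prod>b\<in>Basis. (LINT t|lborel. \<phi> b t))"
    unfolding lborel_eq[where 'a='a]
    by (subst integral_distr)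
      (auto simp: int product_integral_prod lborel_eq_real[symmetric] cong: prod.cong)
qed

lemma integrable_gaussian_real:
  fixes a :: real
  assumes "a > 0"
  shows "integrable lborel (\<lambda>s. exp (- (a * s)\<^sup>2 / 2))"
proof -
  have "integrable lborel (\<lambda>s. sqrt (2 * pi) * std_normal_density (0 + a * s))"
    using assms by (intro integrable_mult_right lborel_integrable_real_affine) auto
  then show ?thesis
    by (simp add: std_normal_density_def)
qed

text \<open>This is the characteristic function of the standard normal distribution, rescaled by
  \<open>a\<close>. Expressing the result as a normal density keeps its positivity and its mass 1 at
  hand.\<close>

lemma fourier_gaussian_real:
  fixes a x :: real
  assumes "a > 0"
  shows "(LINT s|lborel. complex_of_real (exp (- (a * s)\<^sup>2 / 2)) * cis (- (2 * pi * (s * x)))) =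
    complex_of_real (normal_density 0 (a / (2 * pi)) x)"
proof -
  \<comment> \<open>With this \<open>t\<close>, the substitution \<open>u = a * s\<close> turns the
    phase \<open>t * u\<close> into \<open>- (2 * pi * (s * x))\<close>.\<close>
  define t where "t = - (2 * pi * x / a)"
  have "(LINT u|lborel. complex_of_real (std_normal_density u) * cis (t * u)) = exp (- (t\<^sup>2) / 2)"
    using fun_cong[OF char_std_normal_distribution, of t]
    by (simp add: char_def integral_density scaleR_conv_of_real cis_conv_exp)
  also have "(LINT u|lborel. complex_of_real (std_normal_density u) * cis (t * u)) =
      a *\<^sub>R (LINT s|lborel. complex_of_real (std_normal_density (0 + a * s)) * cis (t * (0 + a * s)))"
    using assms by (subst lborel_integral_real_affine[of a _ 0]) auto
  also have "\<dots> = a / sqrt (2 * pi) *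
      (LINT s|lborel. complex_of_real (exp (- (a * s)\<^sup>2 / 2)) * cis (- (2 * pi * (s * x))))"
    using assms
    by (simp add: std_normal_density_def t_def scaleR_conv_of_real field_simps
        flip: integral_mult_right_zero)
  finally have "(LINT s|lborel. complex_of_real (exp (- (a * s)\<^sup>2 / 2)) * cis (- (2 * pi * (s * x)))) =
      sqrt (2 * pi) / a * exp (- (t\<^sup>2) / 2)"
    using assms by (simp add: field_simps)
  also have "sqrt (2 * pi) / a * exp (- (t\<^sup>2) / 2) = normal_density 0 (a / (2 * pi)) x"
    using assms by (simp add: normal_density_def t_def field_simps power2_eq_square real_sqrt_mult real_sqrt_divide)
  finally show ?thesis by (simp only: of_real_mult of_real_divide)
qed

lemma gaussian_eq_prod:
  fixes s :: "'a :: euclidean_space"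
  shows "exp (- (a * norm s)\<^sup>2 / 2) = (\<Prod>b\<in>Basis. exp (- (a * (s \<bullet> b))\<^sup>2 / 2))"
proof -
  have "(norm s)\<^sup>2 = (\<Sum>b\<in>Basis. (s \<bullet> b)\<^sup>2)"
    by (subst power2_norm_eq_inner, subst euclidean_inner) (simp add: power2_eq_square)
  then show ?thesis
    by (simp add: exp_sum[symmetric] power_mult_distrib sum_distrib_left sum_negf sum_divide_distrib)
qed

lemma integrable_gaussian:
  assumes "a > 0"
  shows "integrable lborel (\<lambda>s :: 'a :: euclidean_space. exp (- (a * norm s)\<^sup>2 / 2))"
  unfolding gaussian_eq_prod
  by (rule integrable_lborel_prod[of "\<lambda>_ t. exp (- (a * t)\<^sup>2 / 2)"]) (rule integrable_gaussian_real[OF assms])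

text \<open>Both the Gaussian and the character split into factors that depend on one coordinate
  each, which reduces the claim to dimension one.\<close>

lemma fourier_gaussian:
  fixes x :: "'a :: euclidean_space"
  assumes "a > 0"
  shows "(LINT s|lborel. complex_of_real (exp (- (a * norm s)\<^sup>2 / 2)) * cis (- (2 * pi * (s \<bullet> x)))) =
    complex_of_real (\<Prod>b\<in>Basis. normal_density 0 (a / (2 * pi)) (x \<bullet> b))"
proof -
  define \<phi> where "\<phi> b t = complex_of_real (exp (- (a * t)\<^sup>2 / 2)) * cis (- (2 * pi * (t * (x \<bullet> b))))"
    for b :: 'a and t
  have int: "integrable lborel (\<phi> b)" for b
    by (rule Bochner_Integration.integrable_bound[OF integrable_gaussian_real[OF assms]])
      (auto simp: \<phi>_def[abs_def] norm_mult)
  have cis_sum: "cis (\<Sum>i\<in>I. f i) = (\<Prod>i\<in>I. cis (f i))" if "finite I" for I and f :: "'a \<Rightarrow> real"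
    using that by (induction I) (auto simp: cis_mult[symmetric])
  have "(\<Prod>b\<in>Basis. \<phi> b (s \<bullet> b)) =
      complex_of_real (exp (- (a * norm s)\<^sup>2 / 2)) * cis (- (2 * pi * (s \<bullet> x)))" for s
    unfolding \<phi>_def prod.distrib gaussian_eq_prod
    by (subst cis_sum[symmetric])
      (simp_all add: sum_negf sum_distrib_left[symmetric] euclidean_inner[of s x])
  then show ?thesis
    using integral_lborel_prod[of \<phi>, OF int] fourier_gaussian_real[OF assms]
    by (simp add: \<phi>_def)
qed

text \<open>Translation by \<open>x\<close> only moves the mean in each coordinate, and a product of
  probability densities has mass 1. The mass condition of Schur's test comes from here.\<close>

lemma nn_integral_prod_normal_density:
  fixes x :: "'a :: euclidean_space"
  assumes "\<sigma> > 0"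
  shows "(\<integral>\<^sup>+y. ennreal (\<Prod>b\<in>Basis. normal_density 0 \<sigma> ((y - x) \<bullet> b)) \<partial>lborel) = 1"
proof -
  have one: "(\<integral>\<^sup>+t. ennreal (normal_density \<mu> \<sigma> t) \<partial>lborel) = 1" for \<mu>
    using assms by (subst nn_integral_eq_integral) auto
  have "(\<integral>\<^sup>+y. ennreal (\<Prod>b\<in>Basis. normal_density 0 \<sigma> ((y - x) \<bullet> b)) \<partial>lborel) =
      (\<integral>\<^sup>+y. (\<Prod>b\<in>Basis. ennreal (normal_density (x \<bullet> b) \<sigma> (y \<bullet> b))) \<partial>lborel)"
    by (simp add: prod_ennreal normal_density_def inner_diff_left)
  also have "\<dots> = 1"
    by (subst nn_integral_lborel_prod) (auto simp: one)
  finally show ?thesis .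
qed

section \<open>Plancherel's inequality\<close>

text \<open>The measure is a parameter so that a function on \<Omega> is transformed with respect to
  \<open>lebesgue_on \<Omega>\<close>, without extending it by zero.\<close>

definition fourier :: "'a :: euclidean_space measure \<Rightarrow> ('a \<Rightarrow> complex) \<Rightarrow> 'a \<Rightarrow> complex" where
  "fourier M h s = (LINT x|M. h x * cis (- (2 * pi * (s \<bullet> x))))"

lemma (in pair_sigma_finite) integrable_pair_mult:
  fixes f g :: "_ \<Rightarrow> 'c :: {real_normed_field, banach, second_countable_topology}"
  assumes f: "integrable M1 f" and g: "integrable M2 g"
  shows "integrable (M1 \<Otimes>\<^sub>M M2) (\<lambda>p. f (fst p) * g (snd p))"
proof (rule Fubini_integrable)
  have [measurable]: "f \<in> borel_measurable M1" "g \<in> borel_measurable M2"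
    using f g by auto
  show "(\<lambda>p. f (fst p) * g (snd p)) \<in> borel_measurable (M1 \<Otimes>\<^sub>M M2)"
    by measurable
  show "integrable M1 (\<lambda>x. \<integral>y. norm (f (fst (x, y)) * g (snd (x, y))) \<partial>M2)"
    using f by (simp add: norm_mult)
  show "AE x in M1. integrable M2 (\<lambda>y. f (fst (x, y)) * g (snd (x, y)))"
    using g by simp
qed

lemma borel_measurable_lebesgue_on:
  assumes "f \<in> borel_measurable borel"
  shows "f \<in> borel_measurable (lebesgue_on S)"
proof -
  have "f \<in> borel_measurable lebesgue" using assms by (simp add: measurable_completion)
  then show ?thesis by (rule measurable_restrict_space1)
qed

lemma sigma_finite_lebesgue_on:
  assumes "S \<in> sets lebesgue"
  shows "sigma_finite_measure (lebesgue_on S)"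
proof -
  interpret l: sigma_finite_measure "lebesgue :: 'a measure"
  proof
    obtain A :: "'a set set" where "countable A" "A \<subseteq> sets lborel" "\<Union>A = space lborel"
      "\<forall>a\<in>A. emeasure lborel a \<noteq> \<infinity>"
      using lborel.sigma_finite_countable by blast
    then show "\<exists>A :: 'a set set. countable A \<and> A \<subseteq> sets lebesgue \<and> \<Union>A = space lebesgue \<and>
        (\<forall>a\<in>A. emeasure lebesgue a \<noteq> \<infinity>)"
      by (intro exI[of _ A]) auto
  qed
  show ?thesis
    using sigma_finite_measure_restrict_space[OF l.sigma_finite_measure_axioms assms] .
qed

lemma nn_integral_lebesgue_on_le:
  assumes "S \<in> sets lebesgue"
  shows "(\<integral>\<^sup>+x. f x \<partial>lebesgue_on S) \<le> (\<integral>\<^sup>+x. f x \<partial>lborel)"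
proof -
  have "(\<integral>\<^sup>+x. f x \<partial>lebesgue_on S) = (\<integral>\<^sup>+x. f x * indicator S x \<partial>lebesgue)"
    using assms by (subst nn_integral_restrict_space) auto
  also have "\<dots> \<le> (\<integral>\<^sup>+x. f x \<partial>lebesgue)"
    by (intro nn_integral_mono) (auto simp: indicator_def)
  finally show ?thesis by (simp add: nn_integral_completion)
qed

lemma borel_measurable_fourier:
  assumes "sigma_finite_measure M" "h \<in> borel_measurable M" "(\<lambda>x. x) \<in> borel_measurable M"
  shows "fourier M h \<in> borel_measurable borel"
proof -
  interpret sigma_finite_measure M by fact
  note [measurable] = assms(2,3)
  show ?thesis unfolding fourier_def[abs_def] by measurable
qed

text \<open>
  Schur's test: \<open>2 \<bar>h x\<bar> \<bar>h y\<bar> \<le> \<bar>h x\<bar>\<^sup>2 + \<bar>h y\<bar>\<^sup>2\<close>, and either half integrates to the right-hand side because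
  the kernel has mass at most 1 in each variable.
\<close>

lemma schur_test:
  fixes h :: "'a \<Rightarrow> real" and K :: "'a \<Rightarrow> 'a \<Rightarrow> ennreal"
  assumes "sigma_finite_measure M"
    and [measurable]: "h \<in> borel_measurable M" "(\<lambda>p. K (fst p) (snd p)) \<in> borel_measurable (M \<Otimes>\<^sub>M M)"
    and nn: "\<And>x. h x \<ge> 0"
    and K1: "\<And>x. (\<integral>\<^sup>+y. K x y \<partial>M) \<le> 1"
    and K2: "\<And>y. (\<integral>\<^sup>+x. K x y \<partial>M) \<le> 1"
  shows "(\<integral>\<^sup>+p. ennreal (h (fst p) * h (snd p)) * K (fst p) (snd p) \<partial>(M \<Otimes>\<^sub>M M))
    \<le> (\<integral>\<^sup>+x. ennreal ((h x)\<^sup>2) \<partial>M)"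
proof -
  interpret sigma_finite_measure M by fact
  interpret MM: pair_sigma_finite M M ..
  let ?I = "\<integral>\<^sup>+x. ennreal ((h x)\<^sup>2) \<partial>M"
  have meas_x: "(\<lambda>y. K x y) \<in> borel_measurable M" if "x \<in> space M" for x
    using measurable_compose[OF measurable_Pair1'[OF that] assms(3)] by simp
  have meas_y: "(\<lambda>x. K x y) \<in> borel_measurable M" if "y \<in> space M" for y
    using measurable_compose[OF measurable_Pair2'[OF that] assms(3)] by simp
  have 1: "(\<integral>\<^sup>+p. ennreal ((h (fst p))\<^sup>2) * K (fst p) (snd p) \<partial>(M \<Otimes>\<^sub>M M)) \<le> ?I"
  proof -
    have "(\<integral>\<^sup>+p. ennreal ((h (fst p))\<^sup>2) * K (fst p) (snd p) \<partial>(M \<Otimes>\<^sub>M M)) =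
        (\<integral>\<^sup>+x. \<integral>\<^sup>+y. ennreal ((h x)\<^sup>2) * K x y \<partial>M \<partial>M)"
      using nn_integral_fst[of "\<lambda>p. ennreal ((h (fst p))\<^sup>2) * K (fst p) (snd p)" M] by simp
    also have "\<dots> = (\<integral>\<^sup>+x. ennreal ((h x)\<^sup>2) * (\<integral>\<^sup>+y. K x y \<partial>M) \<partial>M)"
      by (intro nn_integral_cong nn_integral_cmult meas_x)
    also have "\<dots> \<le> (\<integral>\<^sup>+x. ennreal ((h x)\<^sup>2) * 1 \<partial>M)"
      by (intro nn_integral_mono mult_left_mono K1) simp
    finally show ?thesis by simp
  qed
  have 2: "(\<integral>\<^sup>+p. ennreal ((h (snd p))\<^sup>2) * K (fst p) (snd p) \<partial>(M \<Otimes>\<^sub>M M)) \<le> ?I"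
  proof -
    have "(\<integral>\<^sup>+p. ennreal ((h (snd p))\<^sup>2) * K (fst p) (snd p) \<partial>(M \<Otimes>\<^sub>M M)) =
        (\<integral>\<^sup>+y. \<integral>\<^sup>+x. ennreal ((h y)\<^sup>2) * K x y \<partial>M \<partial>M)"
      using MM.nn_integral_snd[of "\<lambda>p. ennreal ((h (snd p))\<^sup>2) * K (fst p) (snd p)"] by simp
    also have "\<dots> = (\<integral>\<^sup>+y. ennreal ((h y)\<^sup>2) * (\<integral>\<^sup>+x. K x y \<partial>M) \<partial>M)"
      by (intro nn_integral_cong nn_integral_cmult meas_y)
    also have "\<dots> \<le> (\<integral>\<^sup>+y. ennreal ((h y)\<^sup>2) * 1 \<partial>M)"
      by (intro nn_integral_mono mult_left_mono K2) simp
    finally show ?thesis by simp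
  qed
  have "2 * (\<integral>\<^sup>+p. ennreal (h (fst p) * h (snd p)) * K (fst p) (snd p) \<partial>(M \<Otimes>\<^sub>M M)) =
      (\<integral>\<^sup>+p. ennreal (2 * (h (fst p) * h (snd p))) * K (fst p) (snd p) \<partial>(M \<Otimes>\<^sub>M M))"
    by (subst nn_integral_cmult[symmetric])
      (simp_all add: ennreal_mult' ennreal_numeral[symmetric] mult.assoc nn del: ennreal_numeral)
  also have "\<dots> \<le> (\<integral>\<^sup>+p. ennreal ((h (fst p))\<^sup>2) * K (fst p) (snd p) +
      ennreal ((h (snd p))\<^sup>2) * K (fst p) (snd p) \<partial>(M \<Otimes>\<^sub>M M))"
  proof (intro nn_integral_mono)
    fix p
    have "2 * (h (fst p) * h (snd p)) \<le> (h (fst p))\<^sup>2 + (h (snd p))\<^sup>2"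
      using sum_squares_bound[of "h (fst p)" "h (snd p)"] by (simp add: mult.assoc)
    then have "ennreal (2 * (h (fst p) * h (snd p))) \<le> ennreal ((h (fst p))\<^sup>2) + ennreal ((h (snd p))\<^sup>2)"
      by (simp add: ennreal_leI flip: ennreal_plus)
    then show "ennreal (2 * (h (fst p) * h (snd p))) * K (fst p) (snd p) \<le>
        ennreal ((h (fst p))\<^sup>2) * K (fst p) (snd p) + ennreal ((h (snd p))\<^sup>2) * K (fst p) (snd p)"
      by (simp flip: distrib_right add: mult_right_mono)
  qed
  also have "\<dots> \<le> ?I + ?I"
    using 1 2 by (subst nn_integral_add) (auto intro: add_mono)
  also have "\<dots> = 2 * ?I" by (simp add: mult_2)
  finally show ?thesis
    by (subst (asm) ennreal_mult_le_mult_iff) auto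
qed

text \<open>Expand the squared modulus of the transform into a double integral over \<open>x\<close>
  and \<open>y\<close>. The Gaussian weight makes Fubini applicable, and integrating over
  \<open>s\<close> first leaves the kernel \<open>K (x - y)\<close>, to which Schur's test
  applies.\<close>

lemma fourier_gaussian_weighted_le:
  fixes S :: "'a :: euclidean_space set"
  assumes S: "S \<in> sets lebesgue" and h: "integrable (lebesgue_on S) h" and a: "a > 0"
  shows "(\<integral>\<^sup>+s. ennreal ((cmod (fourier (lebesgue_on S) h s))\<^sup>2 * exp (- (a * norm s)\<^sup>2 / 2)) \<partial>lborel)
    \<le> (\<integral>\<^sup>+x. ennreal ((cmod (h x))\<^sup>2) \<partial>lebesgue_on S)"
proof -
  define M where "M = lebesgue_on S"
  define \<gamma> :: "'a \<Rightarrow> real" where "\<gamma> s = exp (- (a * norm s)\<^sup>2 / 2)" for s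
  define K where "K x = (\<Prod>b\<in>Basis. normal_density 0 (a / (2 * pi)) (x \<bullet> b))" for x :: 'a
  define e where "e s x = cis (- (2 * pi * (s \<bullet> x)))" for s x :: 'a
  interpret sigma_finite_measure M
    unfolding M_def by (rule sigma_finite_lebesgue_on[OF S])
  interpret MM: pair_sigma_finite M M ..
  interpret MMl: pair_sigma_finite "M \<Otimes>\<^sub>M M" "lborel :: 'a measure" ..
  note h = h[folded M_def]
  have [measurable]: "h \<in> borel_measurable M" using h by auto
  have [measurable]: "(\<lambda>x. x) \<in> borel_measurable M"
    unfolding M_def by (rule borel_measurable_lebesgue_on) simp
  have [measurable]: "K \<in> borel_measurable borel" "\<gamma> \<in> borel_measurable borel"
    unfolding K_def[abs_def] \<gamma>_def[abs_def] by measurable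
  have \<gamma>: "integrable lborel \<gamma>"
    unfolding \<gamma>_def[abs_def] by (rule integrable_gaussian[OF a])
  have FG: "(LINT s|lborel. complex_of_real (\<gamma> s) * e s x) = complex_of_real (K x)" for x
    unfolding \<gamma>_def e_def K_def by (rule fourier_gaussian[OF a])
  have K0: "K x \<ge> 0" for x by (simp add: K_def prod_nonneg)
  \<comment> \<open>The centred normal density is even, so the mass bound in one variable carries
    over to the other.\<close>
  have Ksym: "K (x - y) = K (y - x)" for x y
    by (simp add: K_def normal_density_def inner_diff_left power2_commute)
  have K1: "(\<integral>\<^sup>+y. ennreal (K (y - x)) \<partial>M) \<le> 1" for x
    using nn_integral_lebesgue_on_le[OF S, of "\<lambda>y. ennreal (K (y - x))"]
      nn_integral_prod_normal_density[of "a / (2 * pi)" x] a by (simp add: M_def K_def)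
  have K2: "(\<integral>\<^sup>+y. ennreal (K (x - y)) \<partial>M) \<le> 1" for x
    using K1[of x] by (simp add: Ksym[of x])
  define H where "H p = h (fst p) * cnj (h (snd p))" for p
  have H: "integrable (M \<Otimes>\<^sub>M M) H"
    unfolding H_def[abs_def] using h by (intro MM.integrable_pair_mult) auto
  have [measurable]: "H \<in> borel_measurable (M \<Otimes>\<^sub>M M)" using H by auto
  \<comment> \<open>Characters have modulus 1, so the product of the integrable functions
    \<open>H\<close> and \<open>\<gamma>\<close> dominates.\<close>
  have HG: "integrable ((M \<Otimes>\<^sub>M M) \<Otimes>\<^sub>M lborel) (\<lambda>(p, s). H p * (complex_of_real (\<gamma> s) * e s (fst p - snd p)))"
    by (rule Bochner_Integration.integrable_bound[OF MMl.integrable_pair_mult[OF H, of "\<lambda>s. complex_of_real (\<gamma> s)"]])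
      (auto simp: \<gamma> e_def norm_mult case_prod_beta')
  \<comment> \<open>The square is the transform times its conjugate; the two phases merge into one
    that depends only on the difference of the two points.\<close>
  have abs_sq: "(cmod (fourier M h s))\<^sup>2 = (LINT p|(M \<Otimes>\<^sub>M M). H p * e s (fst p - snd p))" for s
  proof -
    have int: "integrable M (\<lambda>x. h x * e s x)"
      by (rule Bochner_Integration.integrable_bound[OF h]) (auto simp: norm_mult e_def)
    have "complex_of_real ((cmod (fourier M h s))\<^sup>2) = (LINT x|M. h x * e s x) * cnj (LINT y|M. h y * e s y)"
      by (simp only: fourier_def e_def complex_norm_square)
    also have "\<dots> = (LINT x|M. LINT y|M. (h x * e s x) * cnj (h y * e s y))"
      by (simp del: complex_cnj_mult)
    also have "\<dots> = (LINT p|(M \<Otimes>\<^sub>M M). (h (fst p) * e s (fst p)) * cnj (h (snd p) * e s (snd p)))"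
      using MM.integral_fst'[OF MM.integrable_pair_mult[OF int integrable_cnj[OF int]]] by simp
    also have "\<dots> = (LINT p|(M \<Otimes>\<^sub>M M). H p * e s (fst p - snd p))"
      by (intro Bochner_Integration.integral_cong)
        (simp_all add: H_def e_def cis_cnj cis_mult inner_diff_right algebra_simps)
    finally show ?thesis .
  qed
  have weighted: "complex_of_real ((cmod (fourier M h s))\<^sup>2 * \<gamma> s) =
      (LINT p|(M \<Otimes>\<^sub>M M). H p * (complex_of_real (\<gamma> s) * e s (fst p - snd p)))" for s
  proof -
    have "complex_of_real ((cmod (fourier M h s))\<^sup>2 * \<gamma> s) =
        (LINT p|(M \<Otimes>\<^sub>M M). H p * e s (fst p - snd p) * complex_of_real (\<gamma> s))"
      by (simp only: of_real_mult abs_sq integral_mult_left_zero)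
    then show ?thesis by (simp only: mult.assoc mult.commute[of "e s _"])
  qed
  have int: "integrable lborel (\<lambda>s. complex_of_real ((cmod (fourier M h s))\<^sup>2 * \<gamma> s))"
    using MMl.integrable_snd[OF HG] by (simp only: weighted split_conv)
  have "complex_of_real (LINT s|lborel. (cmod (fourier M h s))\<^sup>2 * \<gamma> s) =
      (LINT s|lborel. LINT p|(M \<Otimes>\<^sub>M M). H p * (complex_of_real (\<gamma> s) * e s (fst p - snd p)))"
    by (simp only: weighted flip: integral_complex_of_real)
  also have "\<dots> = (LINT p|(M \<Otimes>\<^sub>M M). LINT s|lborel. H p * (complex_of_real (\<gamma> s) * e s (fst p - snd p)))"
    using MMl.Fubini_integral[OF HG] .
  also have "\<dots> = (LINT p|(M \<Otimes>\<^sub>M M). H p * complex_of_real (K (fst p - snd p)))"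
    by (simp add: FG)
  finally have eq: "complex_of_real (LINT s|lborel. (cmod (fourier M h s))\<^sup>2 * \<gamma> s) =
      (LINT p|(M \<Otimes>\<^sub>M M). H p * complex_of_real (K (fst p - snd p)))" .
  have intr: "integrable lborel (\<lambda>s. (cmod (fourier M h s))\<^sup>2 * \<gamma> s)"
    using int by (simp only: complex_of_real_integrable_eq)
  have "(\<integral>\<^sup>+s. ennreal ((cmod (fourier M h s))\<^sup>2 * \<gamma> s) \<partial>lborel) =
      ennreal (LINT s|lborel. (cmod (fourier M h s))\<^sup>2 * \<gamma> s)"
    by (rule nn_integral_eq_integral[OF intr]) (simp add: \<gamma>_def)
  \<comment> \<open>Passing to the norm allows the complex integral in \<open>eq\<close> to be
    bounded by the integral of its modulus.\<close>
  also have "\<dots> \<le> ennreal (norm (complex_of_real (LINT s|lborel. (cmod (fourier M h s))\<^sup>2 * \<gamma> s)))"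
    by (intro ennreal_leI) simp
  also have "\<dots> \<le> (\<integral>\<^sup>+p. norm (H p * complex_of_real (K (fst p - snd p))) \<partial>(M \<Otimes>\<^sub>M M))"
  proof -
    have "integrable (M \<Otimes>\<^sub>M M) (\<lambda>p. H p * complex_of_real (K (fst p - snd p)))"
      using MMl.integrable_fst[OF HG]
      by (simp add: FG)
    then show ?thesis
      unfolding eq by (rule integral_norm_bound_ennreal)
  qed
  also have "\<dots> = (\<integral>\<^sup>+p. ennreal (cmod (h (fst p)) * cmod (h (snd p))) * ennreal (K (fst p - snd p)) \<partial>(M \<Otimes>\<^sub>M M))"
    by (simp add: H_def norm_mult K0 flip: ennreal_mult)
  also have "\<dots> \<le> (\<integral>\<^sup>+x. ennreal ((cmod (h x))\<^sup>2) \<partial>M)"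
    by (rule schur_test[of M "\<lambda>x. cmod (h x)" "\<lambda>x y. ennreal (K (x - y))"])
      (auto intro!: K1 K2 sigma_finite_measure_axioms)
  finally show ?thesis by (simp add: M_def \<gamma>_def)
qed

text \<open>Fatou's lemma: as the Gaussian widens, the weight tends to 1 pointwise, while the bound
  is the same for every width.\<close>

lemma nn_integral_fourier_le:
  fixes S :: "'a :: euclidean_space set"
  assumes S: "S \<in> sets lebesgue" and h: "integrable (lebesgue_on S) h"
  shows "(\<integral>\<^sup>+s. ennreal ((cmod (fourier (lebesgue_on S) h s))\<^sup>2) \<partial>lborel)
    \<le> (\<integral>\<^sup>+x. ennreal ((cmod (h x))\<^sup>2) \<partial>lebesgue_on S)"
proof -
  let ?F = "fourier (lebesgue_on S) h"
  have [measurable]: "?F \<in> borel_measurable borel"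
    using h by (intro borel_measurable_fourier sigma_finite_lebesgue_on S) (auto intro: borel_measurable_lebesgue_on)
  \<comment> \<open>\<open>inverse (Suc n)\<close> tends to 0 and is positive already at
    \<open>n = 0\<close>, as the weighted inequality requires.\<close>
  define u where "u n s = ennreal ((cmod (?F s))\<^sup>2 * exp (- (inverse (Suc n) * norm s)\<^sup>2 / 2))"
    for n :: nat and s
  have lim: "(\<lambda>n. u n s) \<longlonglongrightarrow> ennreal ((cmod (?F s))\<^sup>2)" for s
  proof -
    have "(\<lambda>n. (cmod (?F s))\<^sup>2 * exp (- (inverse (Suc n) * norm s)\<^sup>2 / 2)) \<longlonglongrightarrow>
        (cmod (?F s))\<^sup>2 * exp (- (0 * norm s)\<^sup>2 / 2)"
      by (intro tendsto_intros LIMSEQ_inverse_real_of_nat) auto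
    then show ?thesis unfolding u_def by (intro tendsto_ennrealI) simp
  qed
  have "(\<integral>\<^sup>+s. ennreal ((cmod (?F s))\<^sup>2) \<partial>lborel) = (\<integral>\<^sup>+s. liminf (\<lambda>n. u n s) \<partial>lborel)"
    by (simp add: lim_imp_Liminf[OF _ lim])
  also have "\<dots> \<le> liminf (\<lambda>n. \<integral>\<^sup>+s. u n s \<partial>lborel)"
    by (rule nn_integral_liminf) (simp add: u_def)
  also have "\<dots> \<le> liminf (\<lambda>n :: nat. \<integral>\<^sup>+x. ennreal ((cmod (h x))\<^sup>2) \<partial>lebesgue_on S)"
    unfolding u_def by (intro Liminf_mono always_eventually allI fourier_gaussian_weighted_le S h) simp
  finally show ?thesis by (simp add: Liminf_const)
qed

section \<open>Averaging a sampled function over translates\<close>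

lemma borel_measurable_indicator_ball:
  "(indicator (ball a r) :: 'a :: euclidean_space \<Rightarrow> 'b :: {second_countable_topology, t2_space, zero_neq_one})
    \<in> borel_measurable (lebesgue_on S)"
  by (rule borel_measurable_lebesgue_on[OF borel_measurable_indicator]) simp

text \<open>By Tonelli and the substitution \<open>s = l + t\<close>, the value \<open>F s\<close>
  is counted once for each point of \<Lambda> in \<open>ball s \<delta>\<close>, hence with
  multiplicity at most \<open>C\<close>.\<close>

lemma nn_integral_average_le:
  fixes F :: "'a :: euclidean_space \<Rightarrow> ennreal"
  assumes "countable \<Lambda>" and [measurable]: "F \<in> borel_measurable borel"
    and C: "\<And>s. (\<integral>\<^sup>+l. indicator (ball s \<delta>) l \<partial>count_space \<Lambda>) \<le> C"
  shows "(\<integral>\<^sup>+t. indicator (ball 0 \<delta>) t * (\<integral>\<^sup>+l. F (l + t) \<partial>count_space \<Lambda>) \<partial>lborel)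
    \<le> C * (\<integral>\<^sup>+s. F s \<partial>lborel)"
proof -
  have shift: "(\<integral>\<^sup>+t. indicator (ball 0 \<delta>) t * F (l + t) \<partial>lborel) =
      (\<integral>\<^sup>+s. F s * indicator (ball s \<delta>) l \<partial>lborel)" for l
  proof -
    have [measurable]: "(\<lambda>s. indicator (ball s \<delta>) l :: ennreal) \<in> borel_measurable borel"
      unfolding indicator_def mem_ball by measurable
    have "(\<integral>\<^sup>+s. F s * indicator (ball s \<delta>) l \<partial>lborel) =
        (\<integral>\<^sup>+s. F s * indicator (ball s \<delta>) l \<partial>distr lborel borel ((+) l))"
      by (simp add: lborel_distr_plus)
    also have "\<dots> = (\<integral>\<^sup>+t. F (l + t) * indicator (ball (l + t) \<delta>) l \<partial>lborel)"
      by (subst nn_integral_distr) auto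
    also have "\<dots> = (\<integral>\<^sup>+t. indicator (ball 0 \<delta>) t * F (l + t) \<partial>lborel)"
      by (intro nn_integral_cong) (simp add: indicator_def dist_norm)
    finally show ?thesis by simp
  qed
  have [measurable]: "ball (0 :: 'a) \<delta> \<in> sets borel" by simp
  have [measurable]: "(\<lambda>t. indicator (ball 0 \<delta>) t * F (l + t)) \<in> borel_measurable borel" for l
    by measurable
  have "(\<integral>\<^sup>+t. indicator (ball 0 \<delta>) t * (\<integral>\<^sup>+l. F (l + t) \<partial>count_space \<Lambda>) \<partial>lborel) =
      (\<integral>\<^sup>+t. \<integral>\<^sup>+l. indicator (ball 0 \<delta>) t * F (l + t) \<partial>count_space \<Lambda> \<partial>lborel)"
    by (intro nn_integral_cong nn_integral_cmult[symmetric]) simp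
  also have "\<dots> = (\<integral>\<^sup>+l. \<integral>\<^sup>+s. F s * indicator (ball s \<delta>) l \<partial>lborel \<partial>count_space \<Lambda>)"
    by (subst nn_integral_count_space_nn_integral) (simp_all add: assms shift)
  also have "\<dots> = (\<integral>\<^sup>+s. \<integral>\<^sup>+l. F s * indicator (ball s \<delta>) l \<partial>count_space \<Lambda> \<partial>lborel)"
    unfolding indicator_def mem_ball
    by (rule nn_integral_count_space_nn_integral[symmetric]) (auto simp: assms)
  also have "\<dots> = (\<integral>\<^sup>+s. F s * (\<integral>\<^sup>+l. indicator (ball s \<delta>) l \<partial>count_space \<Lambda>) \<partial>lborel)"
    by (intro nn_integral_cong nn_integral_cmult) simp
  also have "\<dots> \<le> (\<integral>\<^sup>+s. C * F s \<partial>lborel)"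
    by (intro nn_integral_mono) (simp add: mult.commute[of C] C mult_left_mono)
  also have "\<dots> = C * (\<integral>\<^sup>+s. F s \<partial>lborel)"
    by (rule nn_integral_cmult) simp
  finally show ?thesis .
qed

section \<open>Local finiteness of the frequency sets\<close>

lemma L2_norm_sq: "(L2_norm \<Omega> f)\<^sup>2 = (LINT x|lebesgue_on \<Omega>. (cmod (f x))\<^sup>2)"
  by (simp add: L2_norm_def)

lemma L2_inner_windowed_exp_cis:
  "L2_inner \<Omega> f (windowed_exp g l) =
     (LINT x|lebesgue_on \<Omega>. f x * cnj (g x) * cis (- (2 * pi * (l \<bullet> x))))"
  by (simp add: L2_inner_windowed_exp cis_conv_exp mult_ac)

text \<open>If the mass vanished on every ball of a countable exhaustion, \<open>g\<close> would
  vanish almost everywhere. Bounded support is wanted because nearby frequencies have nearly equal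
  characters only on bounded sets.\<close>

lemma L2_nonzero_local:
  fixes g :: "real ^ 'd \<Rightarrow> complex"
  assumes g: "g \<in> L2_nonzero \<Omega>"
  obtains R where "R > 0" "(LINT x|lebesgue_on \<Omega>. (cmod (g x))\<^sup>2 * indicator (ball 0 R) x) > 0"
proof -
  define M where "M = lebesgue_on \<Omega>"
  let ?G = "\<lambda>R x. (cmod (g x))\<^sup>2 * indicator (ball 0 R) x"
  have int: "integrable M (\<lambda>x. (cmod (g x))\<^sup>2)"
    using g by (auto simp: L2_nonzero_def L2_space_def M_def)
  have [measurable]: "(\<lambda>x. indicator (ball 0 R) x :: real) \<in> borel_measurable M" for R
    unfolding M_def by (rule borel_measurable_indicator_ball)
  have intR: "integrable M (?G R)" for R
    by (rule Bochner_Integration.integrable_bound[OF int], use borel_measurable_integrable[OF int] in measurable)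
      (auto simp: indicator_def)
  have "\<exists>n::nat. integral\<^sup>L M (?G (Suc n)) \<noteq> 0"
  proof (rule ccontr)
    assume "\<not> ?thesis"
    then have "\<forall>n::nat. AE x in M. ?G (Suc n) x = 0"
      using integral_nonneg_eq_0_iff_AE[OF intR] by auto
    then have "AE x in M. \<forall>n::nat. ?G (Suc n) x = 0"
      unfolding AE_all_countable .
    then have "AE x in M. g x = 0"
    proof (rule AE_mp, intro AE_I2 impI)
      fix x assume *: "\<forall>n::nat. ?G (Suc n) x = 0"
      obtain n :: nat where "norm x < n" using reals_Archimedean2 by blast
      then show "g x = 0" using *[rule_format, of n] by (simp add: indicator_def)
    qed
    with g show False unfolding L2_nonzero_def M_def by blast
  qed
  then obtain n :: nat where "integral\<^sup>L M (?G (Suc n)) \<noteq> 0" by blast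
  moreover have "integral\<^sup>L M (?G (Suc n)) \<ge> 0" by (intro integral_nonneg_AE) simp
  ultimately show thesis using that[of "Suc n"] by (simp add: M_def less_le)
qed

text \<open>
  Testing the Bessel inequality on \<open>g\<close> itself, cut off to a ball and modulated by \<open>s\<close>: its inner
  products with the windowed exponentials at frequencies near \<open>s\<close> are bounded away from 0.
\<close>

lemma bessel_imp_locally_finite:
  fixes g :: "real ^ 'd \<Rightarrow> complex"
  assumes g: "g \<in> L2_nonzero \<Omega>"
    and bessel: "\<And>f. f \<in> L2_space \<Omega> \<Longrightarrow>
      (\<integral>\<^sup>+l. ennreal ((cmod (L2_inner \<Omega> f (windowed_exp g l)))\<^sup>2) \<partial>count_space \<Lambda>)
        \<le> ennreal (B * (L2_norm \<Omega> f)\<^sup>2)"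
  shows "\<forall>\<^sub>F \<delta> in at_right 0. \<exists>C::real. \<forall>s. (\<integral>\<^sup>+l. indicator (ball s \<delta>) l \<partial>count_space \<Lambda>) \<le> ennreal C"
proof -
  define M where "M = lebesgue_on \<Omega>"
  obtain R where R: "R > 0" and pos: "(LINT x|M. (cmod (g x))\<^sup>2 * indicator (ball 0 R) x) > 0"
    using L2_nonzero_local[OF g] by (auto simp: M_def)
  define G where "G x = (cmod (g x))\<^sup>2 * indicator (ball 0 R) x" for x
  define I where "I = integral\<^sup>L M G"
  have I: "I > 0" using pos by (simp add: I_def G_def[abs_def])
  have [measurable]: "g \<in> borel_measurable M" "(\<lambda>x. x) \<in> borel_measurable M"
    "(\<lambda>x. indicator (ball 0 R) x :: real) \<in> borel_measurable M"
    "(\<lambda>x. indicator (ball 0 R) x :: complex) \<in> borel_measurable M"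
    using g by (auto simp: L2_nonzero_def L2_space_def M_def intro!: borel_measurable_lebesgue_on borel_measurable_indicator_ball)
  have intg: "integrable M (\<lambda>x. (cmod (g x))\<^sup>2)"
    using g by (auto simp: L2_nonzero_def L2_space_def M_def)
  have intG: "integrable M G"
    by (rule Bochner_Integration.integrable_bound[OF intg]) (auto simp: G_def[abs_def] indicator_def)
  \<comment> \<open>The test function has squared norm \<open>I\<close>, so its Bessel sum is at
    most \<open>B * I\<close>; each frequency in the ball contributes at least
    \<open>(I / 2)\<^sup>2\<close>. The quotient bounds their number.\<close>
  have "(\<integral>\<^sup>+l. indicator (ball s \<delta>) l \<partial>count_space \<Lambda>) \<le> ennreal (B * I / (I / 2)\<^sup>2)"
    if \<delta>: "\<delta> < 1 / (2 * pi * R)" for \<delta> s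
  proof -
    define f where "f x = g x * indicator (ball 0 R) x * cis (2 * pi * (s \<bullet> x))" for x
    have f2: "(cmod (f x))\<^sup>2 = G x" for x
      by (simp add: f_def G_def norm_mult power_mult_distrib indicator_def)
    have f: "f \<in> L2_space \<Omega>"
      using intG unfolding L2_space_def mem_Collect_eq M_def[symmetric] f2
      by (simp add: f_def[abs_def])
    have lower: "(I / 2)\<^sup>2 \<le> (cmod (L2_inner \<Omega> f (windowed_exp g l)))\<^sup>2" if l: "l \<in> ball s \<delta>" for l
    proof -
      define \<theta> where "\<theta> x = 2 * pi * ((s - l) \<bullet> x)" for x
      have [measurable]: "\<theta> \<in> borel_measurable M" unfolding \<theta>_def[abs_def] by measurable
      \<comment> \<open>The restriction on \<delta> keeps the phase within 1, which is less than
        \<open>pi / 3\<close>. That \<delta> is positive follows from \<open>l\<close> lying in the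
        ball.\<close>
      have half: "1 / 2 \<le> cos (\<theta> x)" if "x \<in> ball 0 R" for x
      proof -
        have "\<bar>(s - l) \<bullet> x\<bar> \<le> norm (s - l) * norm x" by (rule Cauchy_Schwarz_ineq2)
        also have "\<dots> \<le> \<delta> * R"
          using l that le_less_trans[OF zero_le_dist, of s l \<delta>] by (intro mult_mono) (auto simp: dist_norm)
        finally have "\<bar>\<theta> x\<bar> \<le> 2 * pi * (\<delta> * R)"
          by (simp add: \<theta>_def abs_mult mult_left_mono)
        also have "\<dots> \<le> 1" using \<delta> R by (simp add: field_simps)
        finally have "\<bar>\<theta> x\<bar> \<le> pi / 3" using pi_gt3 by simp
        then have "cos (pi / 3) \<le> cos \<bar>\<theta> x\<bar>"
          by (intro cos_monotone_0_pi_le) auto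
        then show ?thesis by (simp add: cos_60)
      qed
      have eq: "f x * cnj (g x) * cis (- (2 * pi * (l \<bullet> x))) = complex_of_real (G x) * cis (\<theta> x)" for x
      proof -
        have "cis (2 * pi * (s \<bullet> x)) * cis (- (2 * pi * (l \<bullet> x))) = cis (\<theta> x)"
          by (simp add: cis_mult \<theta>_def inner_diff_left algebra_simps)
        moreover have "complex_of_real (G x) = g x * cnj (g x) * indicator (ball 0 R) x"
          by (simp add: G_def indicator_def flip: complex_norm_square)
        ultimately show ?thesis
          by (simp add: f_def mult_ac)
      qed
      have intc: "integrable M (\<lambda>x. complex_of_real (G x) * cis (\<theta> x))"
        by (rule Bochner_Integration.integrable_bound[OF intG])
          (use intG in \<open>auto simp: norm_mult\<close>)
      \<comment> \<open>The real part bounds the modulus from below; it is the integral of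
        \<open>G x * cos (\<theta> x)\<close>, where the cosine is at least one half on the support
        of \<open>G\<close>.\<close>
      have "I / 2 = (LINT x|M. G x * (1 / 2))" by (simp add: I_def)
      also have "\<dots> \<le> (LINT x|M. Re (complex_of_real (G x) * cis (\<theta> x)))"
      proof (rule integral_mono[OF integrable_mult_left[OF intG] integrable_Re[OF intc]])
        show "G x * (1 / 2) \<le> Re (complex_of_real (G x) * cis (\<theta> x))" for x
          using half[of x] mult_left_mono[of "1 / 2" "cos (\<theta> x)" "(cmod (g x))\<^sup>2"]
          by (auto simp: G_def indicator_def)
      qed
      also have "\<dots> = Re (LINT x|M. complex_of_real (G x) * cis (\<theta> x))"
        by (rule integral_Re[OF intc])
      also have "\<dots> \<le> cmod (LINT x|M. complex_of_real (G x) * cis (\<theta> x))"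
        by (rule complex_Re_le_cmod)
      also have "\<dots> = cmod (L2_inner \<Omega> f (windowed_exp g l))"
        by (simp only: L2_inner_windowed_exp_cis eq M_def)
      finally show ?thesis using I by (intro power_mono) auto
    qed
    have "ennreal ((I / 2)\<^sup>2) * (\<integral>\<^sup>+l. indicator (ball s \<delta>) l \<partial>count_space \<Lambda>) =
        (\<integral>\<^sup>+l. ennreal ((I / 2)\<^sup>2) * indicator (ball s \<delta>) l \<partial>count_space \<Lambda>)"
      by (rule nn_integral_cmult[symmetric]) simp
    also have "\<dots> \<le> (\<integral>\<^sup>+l. ennreal ((cmod (L2_inner \<Omega> f (windowed_exp g l)))\<^sup>2) \<partial>count_space \<Lambda>)"
      using lower by (intro nn_integral_mono) (auto simp: indicator_def intro!: ennreal_leI)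
    also have "\<dots> \<le> ennreal (B * I)"
      using bessel[OF f] by (simp add: L2_norm_sq f2 I_def M_def)
    also have "\<dots> = ennreal ((I / 2)\<^sup>2) * ennreal (B * I / (I / 2)\<^sup>2)"
      using I by (subst ennreal_mult'[symmetric]) auto
    finally show ?thesis
      using I by (subst (asm) ennreal_mult_le_mult_iff) auto
  qed
  then show ?thesis
    using R by (intro eventually_at_rightI[of 0 "1 / (2 * pi * R)"]) auto
qed

section \<open>Indicators and windows cut off to balls\<close>

lemma emeasure_lebesgue_Int_ball:
  fixes \<Omega> :: "'a :: euclidean_space set"
  assumes "\<Omega> \<in> sets lebesgue"
  shows "emeasure lebesgue (\<Omega> \<inter> ball 0 R) < \<infinity>"
proof -
  have "emeasure lebesgue (\<Omega> \<inter> ball 0 R) \<le> emeasure lebesgue (ball (0 :: 'a) R)"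
    using assms by (intro emeasure_mono) auto
  also have "\<dots> < \<infinity>" using emeasure_lborel_ball_finite[of "0 :: 'a" R] by simp
  finally show ?thesis .
qed

lemma
  fixes \<Omega> :: "'a :: euclidean_space set"
  assumes \<Omega>: "\<Omega> \<in> sets lebesgue"
  shows integrable_indicator_ball: "integrable (lebesgue_on \<Omega>) (indicator (ball 0 R) :: 'a \<Rightarrow> real)"
    and integral_indicator_ball:
      "(LINT x|lebesgue_on \<Omega>. indicator (ball 0 R) x) = measure lebesgue (\<Omega> \<inter> ball 0 R)"
proof -
  have eq: "(\<lambda>x. indicator \<Omega> x *\<^sub>R indicator (ball 0 R) x :: real) = indicator (\<Omega> \<inter> ball 0 R)"
    by (auto simp: indicator_def fun_eq_iff)
  have "integrable lebesgue (indicator (\<Omega> \<inter> ball 0 R) :: 'a \<Rightarrow> real)"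
    using \<Omega> emeasure_lebesgue_Int_ball[OF \<Omega>] by (intro integrable_real_indicator) auto
  then show "integrable (lebesgue_on \<Omega>) (indicator (ball 0 R) :: 'a \<Rightarrow> real)"
    using \<Omega> by (subst integrable_restrict_space) (auto simp: eq simp del: real_scaleR_def)
  show "(LINT x|lebesgue_on \<Omega>. indicator (ball 0 R) x) = measure lebesgue (\<Omega> \<inter> ball 0 R)"
    using \<Omega> by (subst integral_restrict_space) (auto simp: eq simp del: real_scaleR_def)
qed

text \<open>On the ball, which has finite measure, the modulus of \<open>g\<close> is at most one
  plus its square. Plancherel's inequality above asks for such an integrable function.\<close>

lemma integrable_indicator_ball_times:
  fixes g :: "real ^ 'd \<Rightarrow> complex"
  assumes \<Omega>: "\<Omega> \<in> sets lebesgue" and g: "g \<in> L2_space \<Omega>"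
  shows "integrable (lebesgue_on \<Omega>) (\<lambda>x. indicator (ball 0 R) x * cnj (g x))"
proof -
  have "integrable (lebesgue_on \<Omega>) (\<lambda>x. indicator (ball 0 R) x + (cmod (g x))\<^sup>2)"
    using g by (intro Bochner_Integration.integrable_add integrable_indicator_ball \<Omega>) (auto simp: L2_space_def)
  then show ?thesis
  proof (rule Bochner_Integration.integrable_bound)
    have "t \<le> 1 + t\<^sup>2" for t :: real
    proof -
      have "2 * t \<le> t\<^sup>2 + 1" using sum_squares_bound[of t 1] by simp
      then show ?thesis using zero_le_power2[of t] by linarith
    qed
    then show "AE x in lebesgue_on \<Omega>. norm (indicator (ball 0 R) x * cnj (g x)) \<le>
        norm (indicator (ball 0 R) x + (cmod (g x))\<^sup>2)"
      by (intro AE_I2) (auto simp: norm_mult indicator_def)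
    show "(\<lambda>x. indicator (ball 0 R) x * cnj (g x)) \<in> borel_measurable (lebesgue_on \<Omega>)"
      using g by (intro borel_measurable_times borel_measurable_indicator_ball
          borel_measurable_continuous_on[of cnj] continuous_intros) (auto simp: L2_space_def)
  qed
qed

lemma borel_measurable_nn_integral_count_space:
  assumes "countable A" "\<And>i. i \<in> A \<Longrightarrow> f i \<in> borel_measurable M"
  shows "(\<lambda>x. \<integral>\<^sup>+i. f i x \<partial>count_space A) \<in> borel_measurable M"
proof -
  interpret sigma_finite_measure "count_space A"
    by (rule sigma_finite_measure_count_space_countable[OF assms(1)])
  show ?thesis
    by (intro borel_measurable_nn_integral, subst measurable_pair_swap_iff)
      (auto intro!: measurable_pair_measure_countable1 assms)
qed

section \<open>Averaging the lower frame bound over modulations\<close>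

theorem theorem1p1:
  fixes \<Omega> :: "(real ^ 'd) set"
    and q :: nat
    and g :: "nat \<Rightarrow> real ^ 'd \<Rightarrow> complex"
    and \<Lambda> :: "nat \<Rightarrow> (real ^ 'd) set"
  assumes "\<Omega> \<in> sets lebesgue"
    and "emeasure lebesgue \<Omega> = \<infinity>"
    and "q \<ge> 1"
    and "\<And>j. j \<in> {1..q} \<Longrightarrow> g j \<in> L2_nonzero \<Omega>"
    and "\<And>j. j \<in> {1..q} \<Longrightarrow> countable (\<Lambda> j)"
  shows "\<not> windowed_exp_frame \<Omega> q g \<Lambda>"
proof
  note \<Omega> = assms(1) and g = assms(4) and \<Lambda> = assms(5)
  define M where "M = lebesgue_on \<Omega>"
  define S where "S j f = (\<integral>\<^sup>+l. ennreal ((cmod (L2_inner \<Omega> f (windowed_exp (g j) l)))\<^sup>2) \<partial>count_space (\<Lambda> j))"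
    for j f
  have sum_S: "(\<Sum>j = 1..q. \<Sum>\<^sub>\<infinity>l\<in>\<Lambda> j. ennreal ((cmod (L2_inner \<Omega> f (windowed_exp (g j) l)))\<^sup>2)) =
      (\<Sum>j = 1..q. S j f)" for f
    unfolding S_def by (intro sum.cong ennreal_infsum_eq_nn_integral \<Lambda>) auto
  assume "windowed_exp_frame \<Omega> q g \<Lambda>"
  then obtain A B :: real where A: "A > 0"
    and frame: "\<And>f. f \<in> L2_space \<Omega> \<Longrightarrow>
        ennreal (A * (L2_norm \<Omega> f)\<^sup>2) \<le> (\<Sum>j = 1..q. S j f) \<and>
        (\<Sum>j = 1..q. S j f) \<le> ennreal (B * (L2_norm \<Omega> f)\<^sup>2)"
    unfolding windowed_exp_frame_def sum_S by blast
  have g_L2: "g j \<in> L2_space \<Omega>" if "j \<in> {1..q}" for j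
    using g[OF that] by (simp add: L2_nonzero_def)
  have "S j f \<le> ennreal (B * (L2_norm \<Omega> f)\<^sup>2)" if "j \<in> {1..q}" "f \<in> L2_space \<Omega>" for j f
  proof -
    have "S j f \<le> (\<Sum>j = 1..q. S j f)" using that(1) by (intro member_le_sum) auto
    then show ?thesis using frame[OF that(2)] by (blast intro: order_trans)
  qed
  then have "\<forall>\<^sub>F \<delta> in at_right 0. \<exists>C::real. \<forall>s. (\<integral>\<^sup>+l. indicator (ball s \<delta>) l \<partial>count_space (\<Lambda> j)) \<le> ennreal C"
    if "j \<in> {1..q}" for j
    using that g[OF that] unfolding S_def by (intro bessel_imp_locally_finite[of "g j" \<Omega> "\<Lambda> j" B]) auto
  \<comment> \<open>There are only finitely many windows, so one radius \<delta> serves all of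
    them.\<close>
  then have "\<forall>\<^sub>F \<delta> in at_right 0. \<delta> > 0 \<and> (\<forall>j\<in>{1..q}. \<exists>C::real. \<forall>s.
      (\<integral>\<^sup>+l. indicator (ball s \<delta>) l \<partial>count_space (\<Lambda> j)) \<le> ennreal C)"
    by (intro eventually_conj eventually_at_right_less eventually_ball_finite) auto
  then obtain \<delta> :: real where \<delta>: "\<delta> > 0" and "\<forall>j\<in>{1..q}. \<exists>C::real. \<forall>s.
      (\<integral>\<^sup>+l. indicator (ball s \<delta>) l \<partial>count_space (\<Lambda> j)) \<le> ennreal C"
    using eventually_happens'[OF trivial_limit_at_right_real] by blast
  then obtain C :: "nat \<Rightarrow> real" where
    C: "\<And>j s. j \<in> {1..q} \<Longrightarrow> (\<integral>\<^sup>+l. indicator (ball s \<delta>) l \<partial>count_space (\<Lambda> j)) \<le> ennreal (C j)"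
    by metis
  \<comment> \<open>\<open>V\<close> and \<open>D\<close> are fixed before the cut-off radius
    \<open>n\<close> is chosen; the bound below is therefore uniform in \<open>n\<close>.\<close>
  define V where "V = ennreal A * emeasure lborel (ball (0 :: real ^ 'd) \<delta>)"
  define D where "D = (\<Sum>j = 1..q. ennreal (C j) * (\<integral>\<^sup>+x. ennreal ((cmod (g j x))\<^sup>2) \<partial>M))"
  have bound: "emeasure lebesgue (\<Omega> \<inter> ball 0 (real n)) * V \<le> D" for n
  proof -
    define h where "h j x = indicator (ball 0 (real n)) x * cnj (g j x)" for j x
    define f where "f t x = indicator (ball 0 (real n)) x * cis (- (2 * pi * (t \<bullet> x)))" for t x :: "real ^ 'd"
    define F where "F j s = ennreal ((cmod (fourier M (h j) s))\<^sup>2)" for j s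
    let ?E = "\<Omega> \<inter> ball 0 (real n)"
    let ?w = "indicator (ball (0 :: real ^ 'd) \<delta>) :: _ \<Rightarrow> ennreal"
    have h: "integrable M (h j)" if "j \<in> {1..q}" for j
      unfolding h_def[abs_def] M_def by (rule integrable_indicator_ball_times[OF \<Omega> g_L2[OF that]])
    have F_meas [measurable]: "F j \<in> borel_measurable borel" if "j \<in> {1..q}" for j
    proof -
      have [measurable]: "fourier M (h j) \<in> borel_measurable borel"
        using h[OF that] unfolding M_def
        by (intro borel_measurable_fourier sigma_finite_lebesgue_on \<Omega>)
          (auto intro!: borel_measurable_lebesgue_on borel_measurable_indicator_ball)
      show ?thesis unfolding F_def[abs_def] by measurable
    qed
    have f_sq: "(cmod (f t x))\<^sup>2 = indicator (ball 0 (real n)) x" for t x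
      by (simp add: f_def norm_mult indicator_def)
    have f_L2: "f t \<in> L2_space \<Omega>" for t
    proof -
      have [measurable]: "(\<lambda>x. indicator (ball 0 (real n)) x :: complex) \<in> borel_measurable M"
        "(\<lambda>x. x) \<in> borel_measurable M"
        unfolding M_def by (auto intro!: borel_measurable_lebesgue_on borel_measurable_indicator_ball)
      have "f t \<in> borel_measurable M" unfolding f_def[abs_def] by measurable
      then show ?thesis
        using integrable_indicator_ball[OF \<Omega>] by (simp add: L2_space_def f_sq M_def)
    qed
    \<comment> \<open>Modulating the indicator by \<open>t\<close> shifts the sampling points of the
      transform of \<open>h j\<close> from \<open>l\<close> to \<open>l + t\<close>.\<close>
    have S_f: "S j (f t) = (\<integral>\<^sup>+l. F j (l + t) \<partial>count_space (\<Lambda> j))" for j t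
    proof -
      have "f t x * cnj (g j x) * cis (- (2 * pi * (l \<bullet> x))) = h j x * cis (- (2 * pi * ((l + t) \<bullet> x)))" for l x
        by (simp add: f_def h_def cis_mult inner_add_left distrib_left mult_ac add.commute)
      then show ?thesis
        by (simp add: S_def F_def fourier_def L2_inner_windowed_exp_cis M_def)
    qed
    have lower: "ennreal A * emeasure lebesgue ?E \<le> (\<Sum>j = 1..q. \<integral>\<^sup>+l. F j (l + t) \<partial>count_space (\<Lambda> j))" for t
    proof -
      \<comment> \<open>The cut-off set has finite measure, so its real-valued
        \<open>measure\<close> agrees with \<open>emeasure\<close>.\<close>
      have "ennreal A * emeasure lebesgue ?E = ennreal (A * (L2_norm \<Omega> (f t))\<^sup>2)"
        unfolding L2_norm_sq f_sq integral_indicator_ball[OF \<Omega>]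
        using A emeasure_lebesgue_Int_ball[OF \<Omega>, of n]
        by (simp add: emeasure_eq_ennreal_measure ennreal_mult')
      then show ?thesis using frame[OF f_L2[of t]] by (simp add: S_f)
    qed
    have "emeasure lebesgue ?E * V = (\<integral>\<^sup>+t. ennreal A * emeasure lebesgue ?E * ?w t \<partial>lborel)"
      by (subst nn_integral_cmult_indicator) (simp_all add: V_def mult_ac)
    also have "\<dots> \<le> (\<integral>\<^sup>+t. (\<Sum>j = 1..q. ?w t * (\<integral>\<^sup>+l. F j (l + t) \<partial>count_space (\<Lambda> j))) \<partial>lborel)"
      using lower by (intro nn_integral_mono) (simp add: mult.commute[of _ "?w _"] mult_left_mono flip: sum_distrib_left)
    also have "\<dots> = (\<Sum>j = 1..q. \<integral>\<^sup>+t. ?w t * (\<integral>\<^sup>+l. F j (l + t) \<partial>count_space (\<Lambda> j)) \<partial>lborel)"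
      by (intro nn_integral_sum borel_measurable_times_ennreal borel_measurable_nn_integral_count_space \<Lambda>)
        (simp_all add: borel_measurable_indicator)
    also have "\<dots> \<le> (\<Sum>j = 1..q. ennreal (C j) * (\<integral>\<^sup>+s. F j s \<partial>lborel))"
      by (intro sum_mono nn_integral_average_le \<Lambda> F_meas C)
    also have "\<dots> \<le> D"
      unfolding D_def
    proof (intro sum_mono mult_left_mono)
      fix j assume j: "j \<in> {1..q}"
      \<comment> \<open>Plancherel bounds the energy of the transform by that of \<open>h j\<close>;
        dropping the cut-off then removes the dependence on \<open>n\<close>.\<close>
      have "(\<integral>\<^sup>+s. F j s \<partial>lborel) \<le> (\<integral>\<^sup>+x. ennreal ((cmod (h j x))\<^sup>2) \<partial>M)"
        using nn_integral_fourier_le[OF \<Omega>] h[OF j] by (simp add: F_def M_def)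
      also have "\<dots> \<le> (\<integral>\<^sup>+x. ennreal ((cmod (g j x))\<^sup>2) \<partial>M)"
        by (intro nn_integral_mono ennreal_leI) (simp add: h_def norm_mult indicator_def)
      finally show "(\<integral>\<^sup>+s. F j s \<partial>lborel) \<le> (\<integral>\<^sup>+x. ennreal ((cmod (g j x))\<^sup>2) \<partial>M)" .
    qed simp
    finally show ?thesis .
  qed
  have "emeasure lebesgue \<Omega> = (SUP n. emeasure lebesgue (\<Omega> \<inter> ball 0 (real n)))"
  proof -
    have "(\<Union>n. \<Omega> \<inter> ball 0 (real n)) = \<Omega>"
      using reals_Archimedean2 by auto
    then show ?thesis
      using \<Omega> by (subst SUP_emeasure_incseq) (auto simp: incseq_def)
  qed
  then have "emeasure lebesgue \<Omega> * V = (SUP n. emeasure lebesgue (\<Omega> \<inter> ball 0 (real n)) * V)"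
    by (simp add: SUP_mult_right_ennreal)
  also have "\<dots> \<le> D" by (intro SUP_least bound)
  finally have "\<infinity> * V \<le> D" using assms(2) by simp
  \<comment> \<open>This excludes the convention \<open>\<infinity> * 0 = 0\<close>, under which the
    preceding inequality would carry no information.\<close>
  moreover have "V \<noteq> 0"
    using A content_ball_pos[OF \<delta>, of "0 :: real ^ 'd"] by (auto simp: V_def measure_def)
  ultimately have "D = \<infinity>" by (simp add: ennreal_top_mult top_unique)
  moreover have "D < \<infinity>"
  proof -
    have "(\<integral>\<^sup>+x. ennreal ((cmod (g j x))\<^sup>2) \<partial>M) < \<infinity>" if "j \<in> {1..q}" for j
      using g_L2[OF that] nn_integral_eq_integral[of M "\<lambda>x. (cmod (g j x))\<^sup>2"]
      by (simp add: L2_space_def M_def)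
    then show ?thesis
      by (auto simp: D_def ennreal_mult_less_top)
  qed
  ultimately show False by simp
qed

end
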